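(* Let $W\subset\mathbb{R}^n$ be open, let $K\subset W$ be a compact set, and let $f:W\to\mathbb{R}^n$ be a smooth ($C^\infty$) function. Fix a center $\mathfrak{c}\in W$. Then for every $\epsilon>0$ there exist an analytic map $g:W\to\mathbb{R}^n$ (a polynomial map suffices) and $m\in\mathbb{N}$ such that the structured Taylor approximant $$\tilde f(y)=\sum_{k=0}^{m}\frac{1}{k!}\,\mathcal{J}^{[k]}(g)(\mathfrak{c})\cdot\phi^{[k]}(y-\mathfrak{c})$$ satisfies $$\|f-\tilde f\|_{C^0(K)}<\epsilon.$$ That is, the set of structured multivariate Taylor approximants (with coefficients taken from an analytic surrogate $g$) is dense in $C^\infty(K;\mathbb{R}^n)$ under the uniform topology.
   Context: For $m\in\mathbb{N}=\{0,1,2,\dots\}$ let $N_m=\binom{n+m-1}{n-1}$, the number of multi-indices $(m_1,\dots,m_n)$ of nonnegative integers with $m_1+\cdots+m_n=m$; fix an ordering of these multi-indices. Generalized derivative matrix: for a smooth map $g=(g_1,\dots,g_n)$ from an open subset of $\mathbb{R}^n$ to $\mathbb{R}^n$ and a point $\mathfrak{c}$ in its domain, $\mathcal{J}^{[m]}(g)(\mathfrak{c})\in\mathbb{R}^{n\times N_m}$ is the matrix whose $i$-th row, in the column of the multi-index $(m_1,\dots,m_n)$, has entry $\frac{\partial^m g_i}{\partial y_1^{m_1}\cdots\partial y_n^{m_n}}(\mathfrak{c})$; for $m=0$ it is $g(\mathfrak{c})$. Generalized monomial vector: for $y,\mathfrak{c}\in\mathbb{R}^n$, $\phi^{[m]}(y-\mathfrak{c})\in\mathbb{R}^{N_m}$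 is the column vector whose entry at the multi-index $(m_1,\dots,m_n)$ (same ordering) is $\frac{m!}{m_1!\cdots m_n!}(y_1-\mathfrak{c}_1)^{m_1}\cdots(y_n-\mathfrak{c}_n)^{m_n}$; in particular $\phi^{[0]}=1$. The dot denotes the matrix–vector product. $\|h\|_{C^0(K)}=\sup_{y\in K}\|h(y)\|$ with $\|\cdot\|$ the Euclidean norm. Elements of $C^\infty(K;\mathbb{R}^n)$ are restrictions to $K$ of smooth maps defined on an open set $W\supset K$. *)

theory Defs
  imports "HOL-Analysis.Analysis"
begin

text \<open>
  Points of \<open>\<real>\<^sup>n\<close> are vectors of type \<open>real ^ 'n\<close> (written \<open>'n rvec\<close>) with \<open>n = CARD('n)\<close>; the linear order on \<open>'n\<close>
  is the order \<open>1, \<dots>, n\<close> of the coordinates (it fixes the order in which mixed partial derivatives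
  are taken).  A multi-index is a function \<open>'n \<Rightarrow> nat\<close>.
\<close>

type_synonym 'n rvec = "(real, 'n) vec"


section \<open>Multi-indices\<close>

definition multi_indices :: "nat \<Rightarrow> ('n::finite \<Rightarrow> nat) set" where
  "multi_indices m = {\<alpha>. (\<Sum>i\<in>UNIV. \<alpha> i) = m}"

definition num_multi_indices :: "'n::finite itself \<Rightarrow> nat \<Rightarrow> nat" where
  "num_multi_indices _ m = (CARD('n) + m - 1) choose (CARD('n) - 1)"

lemma card_multi_indices:
  "finite (multi_indices m :: ('n::{finite,linorder} \<Rightarrow> nat) set)"
  "card (multi_indices m :: ('n::{finite,linorder} \<Rightarrow> nat) set) = num_multi_indices TYPE('n) m"
proof -
  define xs where "xs = sorted_list_of_set (UNIV :: 'n set)"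
  have xs: "distinct xs" "set xs = UNIV" "length xs = CARD('n)"
    by (simp_all add: xs_def)
  have pos: "CARD('n) \<ge> 1"
    by (simp add: Suc_leI)
  let ?L = "{l::nat list. length l = CARD('n) \<and> sum_list l = m}"
  have inj: "inj_on (\<lambda>\<alpha>. map \<alpha> xs) (multi_indices m)"
    by (rule inj_onI) (use xs(2) in \<open>auto simp: map_eq_conv\<close>)
  have img: "(\<lambda>\<alpha>. map \<alpha> xs) ` multi_indices m = ?L"
  proof (intro equalityI subsetI)
    fix l assume "l \<in> (\<lambda>\<alpha>. map \<alpha> xs) ` multi_indices m"
    then show "l \<in> ?L"
      using xs by (auto simp: multi_indices_def sum_list_distinct_conv_sum_set)
  next
    fix l :: "nat list" assume l: "l \<in> ?L"
    define \<alpha> where "\<alpha> = (\<lambda>i. the (map_of (zip xs l) i))"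
    have "map \<alpha> xs = l"
    proof (rule nth_equalityI)
      fix k assume "k < length (map \<alpha> xs)"
      then show "map \<alpha> xs ! k = l ! k"
        using xs l by (simp add: \<alpha>_def map_of_zip_nth)
    qed (use xs l in auto)
    moreover from this have "\<alpha> \<in> multi_indices m"
      using xs l sum_list_distinct_conv_sum_set[of xs \<alpha>] by (auto simp: multi_indices_def)
    ultimately show "l \<in> (\<lambda>\<alpha>. map \<alpha> xs) ` multi_indices m"
      by (metis image_eqI)
  qed
  have "finite {l::nat list. set l \<subseteq> {..m} \<and> length l = CARD('n)}"
    by (rule finite_lists_length_eq) simp
  moreover have "?L \<subseteq> {l. set l \<subseteq> {..m} \<and> length l = CARD('n)}"
    using member_le_sum_list by fastforce
  ultimately have "finite ?L"
    using finite_subset by blast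
  then show "finite (multi_indices m :: ('n \<Rightarrow> nat) set)"
    using finite_imageD inj img by metis
  have "card (multi_indices m :: ('n \<Rightarrow> nat) set) = card ?L"
    using card_image[OF inj] img by simp
  also have "\<dots> = (m + CARD('n) - 1) choose m"
    by (rule card_length_sum_list)
  also have "\<dots> = num_multi_indices TYPE('n) m"
    using binomial_symmetric[of m "m + CARD('n) - 1"] trans_le_add2[OF pos, of m]
      le_add_diff[OF pos, of m] pos by (simp add: num_multi_indices_def add.commute)
  finally show "card (multi_indices m :: ('n \<Rightarrow> nat) set) = num_multi_indices TYPE('n) m" .
qed

text \<open>
  An ordering of the multi-indices of each order: \<open>idx m j\<close> is the multi-index labelling column
  \<open>j\<close>, where columns are numbered from \<open>0\<close> to \<open>N\<^sub>m - 1\<close>.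
\<close>

definition multi_index_ordering :: "(nat \<Rightarrow> nat \<Rightarrow> 'n::finite \<Rightarrow> nat) \<Rightarrow> bool" where
  "multi_index_ordering idx \<longleftrightarrow>
     (\<forall>m. bij_betw (idx m) {..<num_multi_indices TYPE('n) m} (multi_indices m))"

lemma multi_index_ordering_exists:
  "\<exists>idx :: nat \<Rightarrow> nat \<Rightarrow> 'n::{finite,linorder} \<Rightarrow> nat. multi_index_ordering idx"
proof -
  have "\<exists>e. bij_betw e {..<num_multi_indices TYPE('n) m} (multi_indices m :: ('n \<Rightarrow> nat) set)" for m
    by (rule finite_same_card_bij) (simp_all add: card_multi_indices)
  then show ?thesis
    unfolding multi_index_ordering_def by metis
qed


section \<open>Smooth and real-analytic maps\<close>

text \<open>Intended for open \<open>S\<close>, where it is the usual class \<open>C\<^sup>k\<close>.\<close>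

primrec Ck_on :: "nat \<Rightarrow> ('a::real_normed_vector \<Rightarrow> 'b::real_normed_vector) \<Rightarrow> 'a set \<Rightarrow> bool" where
  "Ck_on 0 f S \<longleftrightarrow> continuous_on S f"
| "Ck_on (Suc k) f S \<longleftrightarrow>
     (\<forall>x\<in>S. f differentiable (at x)) \<and> (\<forall>v. Ck_on k (\<lambda>x. frechet_derivative f (at x) v) S)"

definition smooth_on :: "('a::real_normed_vector \<Rightarrow> 'b::real_normed_vector) \<Rightarrow> 'a set \<Rightarrow> bool" where
  "smooth_on f S \<longleftrightarrow> (\<forall>k. Ck_on k f S)"

text \<open>Local expansion into an (unconditionally convergent) power series in several variables.\<close>

definition real_analytic_on ::
    "('n::finite rvec \<Rightarrow> 'b::real_normed_vector) \<Rightarrow> 'n rvec set \<Rightarrow> bool" where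
  "real_analytic_on g S \<longleftrightarrow>
     (\<forall>a\<in>S. \<exists>r>0. \<exists>C :: ('n \<Rightarrow> nat) \<Rightarrow> 'b. \<forall>y\<in>ball a r.
        ((\<lambda>\<alpha>. (\<Prod>i\<in>UNIV. (y $ i - a $ i) ^ \<alpha> i) *\<^sub>R C \<alpha>) has_sum g y) UNIV)"


section \<open>Structured Taylor approximants\<close>

definition partial_deriv :: "'n::finite \<Rightarrow> ('n rvec \<Rightarrow> real) \<Rightarrow> 'n rvec \<Rightarrow> real" where
  "partial_deriv i h x = deriv (\<lambda>t. h (x + t *\<^sub>R axis i 1)) 0"

text \<open>\<open>\<partial>\<^sub>1\<^sup>\<alpha>\<^sup>1 (\<partial>\<^sub>2\<^sup>\<alpha>\<^sup>2 (\<dots> h))\<close>, the derivative in the last coordinate being taken first.\<close>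

definition mixed_partial ::
    "('n::{finite,linorder} \<Rightarrow> nat) \<Rightarrow> ('n rvec \<Rightarrow> real) \<Rightarrow> 'n rvec \<Rightarrow> real" where
  "mixed_partial \<alpha> h = foldr (\<lambda>i. partial_deriv i ^^ \<alpha> i) (sorted_list_of_set UNIV) h"

text \<open>
  An \<open>n \<times> N\<close> matrix is a function of a row \<open>i :: 'n\<close> and a column number \<open>j < N\<close>, and a column
  vector of length \<open>N\<close> is a function of \<open>j < N\<close>.
\<close>

definition deriv_matrix ::
    "(nat \<Rightarrow> nat \<Rightarrow> 'n::{finite,linorder} \<Rightarrow> nat) \<Rightarrow> nat \<Rightarrow> ('n rvec \<Rightarrow> 'n rvec) \<Rightarrow> 'n rvec
      \<Rightarrow> 'n \<Rightarrow> nat \<Rightarrow> real" where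
  "deriv_matrix idx m g c i j = mixed_partial (idx m j) (\<lambda>y. g y $ i) c"

definition monomial_vector ::
    "(nat \<Rightarrow> nat \<Rightarrow> 'n::finite \<Rightarrow> nat) \<Rightarrow> nat \<Rightarrow> 'n rvec \<Rightarrow> nat \<Rightarrow> real" where
  "monomial_vector idx m z j =
     fact m / (\<Prod>i\<in>UNIV. fact (idx m j i)) * (\<Prod>i\<in>UNIV. (z $ i) ^ idx m j i)"

definition mat_vec :: "nat \<Rightarrow> ('n::finite \<Rightarrow> nat \<Rightarrow> real) \<Rightarrow> (nat \<Rightarrow> real) \<Rightarrow> 'n rvec" where
  "mat_vec N A v = (\<chi> i. \<Sum>j<N. A i j * v j)"

definition structured_taylor ::
    "(nat \<Rightarrow> nat \<Rightarrow> 'n::{finite,linorder} \<Rightarrow> nat) \<Rightarrow> ('n rvec \<Rightarrow> 'n rvec) \<Rightarrow> 'n rvec \<Rightarrow> nat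
      \<Rightarrow> 'n rvec \<Rightarrow> 'n rvec" where
  "structured_taylor idx g c m y =
     (\<Sum>k\<le>m. (1 / fact k) *\<^sub>R
        mat_vec (num_multi_indices TYPE('n) k) (deriv_matrix idx k g c) (monomial_vector idx k (y - c)))"


section \<open>Function spaces on a compact set\<close>

text \<open>The supremum of norms is taken in \<open>[0, \<infinity>)\<close>, hence \<open>0\<close> for empty \<open>K\<close>
  (\<open>Sup\<close> of the empty set is unspecified on type \<open>real\<close>).\<close>

definition C0_norm :: "'a set \<Rightarrow> ('a \<Rightarrow> 'b::real_normed_vector) \<Rightarrow> real" where
  "C0_norm K h = (if K = {} then 0 else SUP y\<in>K. norm (h y))"

text \<open>
  Maps on \<open>K\<close> are represented as extensional functions (as in \<^const>\<open>cfunspace\<close>, which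
  carries the supremum metric).
\<close>

definition Cinf :: "'a::real_normed_vector set \<Rightarrow> ('a \<Rightarrow> 'b::real_normed_vector) set" where
  "Cinf K = {restrict h K |h. \<exists>U. open U \<and> K \<subseteq> U \<and> smooth_on h U}"

definition structured_approximants ::
    "(nat \<Rightarrow> nat \<Rightarrow> 'n::{finite,linorder} \<Rightarrow> nat) \<Rightarrow> 'n rvec set \<Rightarrow> 'n rvec \<Rightarrow> 'n rvec set
      \<Rightarrow> ('n rvec \<Rightarrow> 'n rvec) set" where
  "structured_approximants idx W c K =
     {restrict (structured_taylor idx g c m) K |g m. real_analytic_on g W}"

end

(*
  By the Stone-Weierstrass theorem f is uniformly close on K to a polynomial map g.  Rewriting g in
  powers of y - c and differentiating termwise at c recovers its coefficients up to the factor
  alpha!, so the Taylor sum of g of any order at least its degree is g itself.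
  Conversely, every structured approximant is polynomial, hence smooth.
*)
theory Submission
  imports Defs
begin

section \<open>Monomials and multi-indices of bounded order\<close>

definition monomial_at :: "('n::finite \<Rightarrow> nat) \<Rightarrow> 'n rvec \<Rightarrow> real" where
  "monomial_at \<alpha> z = (\<Prod>i\<in>UNIV. (z $ i) ^ \<alpha> i)"

definition multi_indices_upto :: "nat \<Rightarrow> ('n::finite \<Rightarrow> nat) set" where
  "multi_indices_upto m = {\<alpha>. (\<Sum>i\<in>UNIV. \<alpha> i) \<le> m}"

lemma multi_indices_upto_conv_UN: "multi_indices_upto m = (\<Union>k\<le>m. multi_indices k)"
  by (auto simp: multi_indices_upto_def multi_indices_def)

lemma finite_multi_indices_upto [simp]:
  "finite (multi_indices_upto m :: ('n::{finite,linorder} \<Rightarrow> nat) set)"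
  by (simp add: multi_indices_upto_conv_UN card_multi_indices(1))

text \<open>Lets a Taylor sum, which is grouped by order, be read as one sum over multi-indices. The
  groups are disjoint because a multi-index has only one order.\<close>

lemma sum_multi_indices_upto:
  fixes F :: "('n::{finite,linorder} \<Rightarrow> nat) \<Rightarrow> 'b::comm_monoid_add"
  shows "sum F (multi_indices_upto m) = (\<Sum>k\<le>m. sum F (multi_indices k))"
  unfolding multi_indices_upto_conv_UN
  by (rule sum.UNION_disjoint) (auto simp: card_multi_indices(1), auto simp: multi_indices_def)

lemma monomial_at_mult:
  "monomial_at \<alpha> z * monomial_at \<beta> z = monomial_at (\<lambda>i. \<alpha> i + \<beta> i) z"
  by (simp add: monomial_at_def power_add prod.distrib)

lemma monomial_at_zero_index [simp]: "monomial_at (\<lambda>_. 0) z = 1"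
  by (simp add: monomial_at_def)

lemma monomial_at_unit_index: "monomial_at (\<lambda>j. if j = i then 1 else 0) z = z $ i"
proof -
  have "monomial_at (\<lambda>j. if j = i then 1 else 0) z = (\<Prod>j\<in>UNIV. if j = i then z $ j else 1)"
    unfolding monomial_at_def by (rule prod.cong) auto
  then show ?thesis by simp
qed

lemma monomial_at_zero: "monomial_at \<alpha> 0 = (if \<alpha> = (\<lambda>_. 0) then 1 else 0)"
  by (auto simp: monomial_at_def power_0_left fun_eq_iff)

section \<open>Expansion of polynomials around a point\<close>

text \<open>The expansion is required for every large truncation order \<open>M\<close>, so that expansions of
  different degrees can be added coefficientwise.\<close>

definition expands_around :: "'n::finite rvec \<Rightarrow> ('n rvec \<Rightarrow> real) \<Rightarrow> (('n \<Rightarrow> nat) \<Rightarrow> real) \<Rightarrow> nat \<Rightarrow> bool"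
  where "expands_around a h C N \<longleftrightarrow>
    (\<forall>M\<ge>N. \<forall>y. h y = (\<Sum>\<alpha>\<in>multi_indices_upto M. C \<alpha> * monomial_at \<alpha> (y - a)))"

definition expandable_around :: "'n::finite rvec \<Rightarrow> ('n rvec \<Rightarrow> real) \<Rightarrow> bool" where
  "expandable_around a h \<longleftrightarrow> (\<exists>C N. expands_around a h C N)"

lemma expands_aroundD:
  "expands_around a h C N \<Longrightarrow> h y = (\<Sum>\<alpha>\<in>multi_indices_upto N. C \<alpha> * monomial_at \<alpha> (y - a))"
  by (simp add: expands_around_def)

lemma expandable_around_monomial:
  fixes a :: "'n::{finite,linorder} rvec"
  shows "expandable_around a (\<lambda>y. d * monomial_at \<gamma> (y - a))"
proof -
  have "expands_around a (\<lambda>y. d * monomial_at \<gamma> (y - a)) (\<lambda>\<alpha>. if \<alpha> = \<gamma> then d else 0) (\<Sum>i\<in>UNIV. \<gamma> i)"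
    unfolding expands_around_def
  proof (intro allI impI)
    fix M y assume "(\<Sum>i\<in>UNIV. \<gamma> i) \<le> M"
    then have "\<gamma> \<in> multi_indices_upto M"
      by (simp add: multi_indices_upto_def)
    then show "d * monomial_at \<gamma> (y - a) =
        (\<Sum>\<alpha>\<in>multi_indices_upto M. (if \<alpha> = \<gamma> then d else 0) * monomial_at \<alpha> (y - a))"
      by (simp add: if_distrib[of "\<lambda>x. x * _"] cong: if_cong)
  qed
  then show ?thesis
    unfolding expandable_around_def by blast
qed

lemma expandable_around_const:
  fixes a :: "'n::{finite,linorder} rvec"
  shows "expandable_around a (\<lambda>_. d)"
  using expandable_around_monomial[of a d "\<lambda>_. 0"] by simp

lemma expandable_around_add:
  assumes "expandable_around a h" "expandable_around a k"
  shows "expandable_around a (\<lambda>y. h y + k y)"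
proof -
  obtain C N D M where "expands_around a h C N" "expands_around a k D M"
    using assms unfolding expandable_around_def by blast
  then have "expands_around a (\<lambda>y. h y + k y) (\<lambda>\<alpha>. C \<alpha> + D \<alpha>) (max N M)"
    by (auto simp: expands_around_def sum.distrib distrib_right)
  then show ?thesis
    unfolding expandable_around_def by blast
qed

lemma expandable_around_sum:
  fixes a :: "'n::{finite,linorder} rvec"
  assumes "finite I" "\<And>i. i \<in> I \<Longrightarrow> expandable_around a (h i)"
  shows "expandable_around a (\<lambda>y. \<Sum>i\<in>I. h i y)"
  using assms
  by (induction I rule: finite_induct) (simp_all add: expandable_around_const expandable_around_add)

text \<open>The product is written as a double sum of monomials with added exponents, each
  expandable by itself. Closure under finite sums then collects equal exponents, so no convolution
  of coefficients is computed.\<close>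

lemma expandable_around_mult:
  fixes a :: "'n::{finite,linorder} rvec"
  assumes "expandable_around a h" "expandable_around a k"
  shows "expandable_around a (\<lambda>y. h y * k y)"
proof -
  obtain C N D M where "expands_around a h C N" "expands_around a k D M"
    using assms unfolding expandable_around_def by blast
  then have "(\<lambda>y. h y * k y) = (\<lambda>y. \<Sum>\<alpha>\<in>multi_indices_upto N. \<Sum>\<beta>\<in>multi_indices_upto M.
      (C \<alpha> * D \<beta>) * monomial_at (\<lambda>i. \<alpha> i + \<beta> i) (y - a))"
    by (simp add: expands_aroundD[of a h] expands_aroundD[of a k] sum_product mult_ac
        flip: monomial_at_mult)
  then show ?thesis
    by (simp add: expandable_around_sum expandable_around_monomial)
qed

text \<open>Base case of the induction over \<open>real_polynomial_function\<close>: write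
  \<open>h y\<close> as \<open>h a\<close> plus the value of \<open>h\<close> at
  \<open>y - a\<close>, and expand \<open>y - a\<close> in the standard basis.\<close>

lemma expandable_around_linear:
  fixes a :: "'n::{finite,linorder} rvec"
  assumes "bounded_linear h"
  shows "expandable_around a h"
proof -
  interpret bounded_linear h by fact
  have "h y = h a + (\<Sum>i\<in>UNIV. h (axis i 1) * monomial_at (\<lambda>j. if j = i then 1 else 0) (y - a))" for y
  proof -
    have "y = a + (\<Sum>i\<in>UNIV. (y - a) $ i *\<^sub>R axis i 1)"
      using basis_expansion[of "y - a"] by (simp add: scalar_mult_eq_scaleR)
    then have "h y = h (a + (\<Sum>i\<in>UNIV. (y - a) $ i *\<^sub>R axis i 1))"
      by simp
    also have "\<dots> = h a + (\<Sum>i\<in>UNIV. h (axis i 1) * (y - a) $ i)"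
      by (simp only: add sum scaleR real_scaleR_def mult.commute)
    finally show ?thesis
      by (simp only: monomial_at_unit_index)
  qed
  then have "h = (\<lambda>y. h a + (\<Sum>i\<in>UNIV. h (axis i 1) * monomial_at (\<lambda>j. if j = i then 1 else 0) (y - a)))"
    by blast
  moreover have "expandable_around a \<dots>"
    by (intro expandable_around_add expandable_around_const expandable_around_sum
        expandable_around_monomial) simp
  ultimately show ?thesis by simp
qed

lemma real_polynomial_function_expandable:
  fixes a :: "'n::{finite,linorder} rvec"
  assumes "real_polynomial_function h"
  shows "expandable_around a h"
  using assms
  by induction (simp_all add: expandable_around_linear expandable_around_const
      expandable_around_add expandable_around_mult)

section \<open>Expansion and analyticity of vector-valued polynomials\<close>

lemma polynomial_function_nth:
  fixes g :: "'a::real_normed_vector \<Rightarrow> 'n::finite rvec"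
  shows "polynomial_function g \<longleftrightarrow> (\<forall>i. real_polynomial_function (\<lambda>y. g y $ i))"
  by (auto simp: polynomial_function_iff_Basis_inner Basis_vec_def inner_axis)

lemma polynomial_function_expansion:
  fixes g :: "'a::{finite,linorder} rvec \<Rightarrow> 'n::finite rvec"
  assumes "polynomial_function g"
  obtains C N where "\<And>i. expands_around a (\<lambda>y. g y $ i) (C i) N"
proof -
  have "\<forall>i. \<exists>C N. expands_around a (\<lambda>y. g y $ i) C N"
    using assms real_polynomial_function_expandable
    unfolding polynomial_function_nth expandable_around_def by blast
  then obtain C N where CN: "\<And>i. expands_around a (\<lambda>y. g y $ i) (C i) (N i)"
    by metis
  \<comment> \<open>The finitely many components get a common threshold; enlarging it is harmless
    because an expansion holds at every larger order.\<close>
  have "N i \<le> Max (range N)" for i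
    by simp
  with CN have "expands_around a (\<lambda>y. g y $ i) (C i) (Max (range N))" for i
    unfolding expands_around_def using le_trans by blast
  with that show thesis by blast
qed

lemma real_analytic_on_polynomial_function:
  fixes g :: "'a::{finite,linorder} rvec \<Rightarrow> 'n::finite rvec"
  assumes "polynomial_function g"
  shows "real_analytic_on g S"
  unfolding real_analytic_on_def
proof
  fix a assume "a \<in> S"
  obtain C N where CN: "\<And>i. expands_around a (\<lambda>y. g y $ i) (C i) N"
    using polynomial_function_expansion[OF assms] by blast
  \<comment> \<open>Cutting the coefficients off beyond order \<open>N\<close> makes the series a
    finite sum, without a proof that \<open>C i\<close> vanishes there.\<close>
  define D where "D \<alpha> = (if \<alpha> \<in> multi_indices_upto N then (\<chi> i. C i \<alpha>) else 0)" for \<alpha>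
  have "((\<lambda>\<alpha>. (\<Prod>i\<in>UNIV. (y $ i - a $ i) ^ \<alpha> i) *\<^sub>R D \<alpha>) has_sum g y) UNIV" for y
  proof (rule has_sum_finite_neutralI[of "multi_indices_upto N"])
    have "g y $ i = (\<Sum>\<alpha>\<in>multi_indices_upto N. (\<Prod>j\<in>UNIV. (y $ j - a $ j) ^ \<alpha> j) *\<^sub>R D \<alpha>) $ i" for i
      using expands_aroundD[OF CN, of y i] by (simp add: D_def monomial_at_def mult.commute)
    then show "g y = (\<Sum>\<alpha>\<in>multi_indices_upto N. (\<Prod>j\<in>UNIV. (y $ j - a $ j) ^ \<alpha> j) *\<^sub>R D \<alpha>)"
      by (simp add: vec_eq_iff)
  qed (auto simp: D_def)
  \<comment> \<open>The expansion is valid for every \<open>y\<close>, so radius 1 serves.\<close>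
  then show "\<exists>r>0. \<exists>C. \<forall>y\<in>ball a r.
      ((\<lambda>\<alpha>. (\<Prod>i\<in>UNIV. (y $ i - a $ i) ^ \<alpha> i) *\<^sub>R C \<alpha>) has_sum g y) UNIV"
    by (meson zero_less_one)
qed

section \<open>Mixed partial derivatives of polynomials\<close>

text \<open>Only the factor of coordinate \<open>i\<close> depends on \<open>t\<close>. If
  \<open>\<beta> i = 0\<close>, the truncated exponent does no harm, since the factor
  \<open>real (\<beta> i)\<close> is zero.\<close>

lemma has_real_derivative_monomial_at:
  "((\<lambda>t. monomial_at \<beta> (z + t *\<^sub>R axis i 1)) has_real_derivative
     real (\<beta> i) * monomial_at (\<beta>(i := \<beta> i - 1)) z) (at 0)"
proof -
  have split: "monomial_at \<gamma> w = (w $ i) ^ \<gamma> i * (\<Prod>j\<in>UNIV - {i}. (w $ j) ^ \<gamma> j)" for \<gamma> and w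
    unfolding monomial_at_def by (rule prod.remove) auto
  have "monomial_at \<beta> (z + t *\<^sub>R axis i 1) = (z $ i + t) ^ \<beta> i * (\<Prod>j\<in>UNIV - {i}. (z $ j) ^ \<beta> j)" for t
    unfolding split by (simp add: axis_def)
  moreover have "monomial_at (\<beta>(i := \<beta> i - 1)) z = (z $ i) ^ (\<beta> i - 1) * (\<Prod>j\<in>UNIV - {i}. (z $ j) ^ \<beta> j)"
    unfolding split by simp
  ultimately show ?thesis
    by (auto intro!: derivative_eq_intros)
qed

text \<open>The sum runs over an abstract index set \<open>B\<close> with exponents
  \<open>\<gamma> b\<close>, so that repeated differentiation changes the exponents but not the
  index set, even when exponents come to coincide.\<close>

lemma partial_deriv_sum_monomial_at:
  assumes "finite B"
  shows "partial_deriv i (\<lambda>y. \<Sum>b\<in>B. d b * monomial_at (\<gamma> b) (y - a)) =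
    (\<lambda>y. \<Sum>b\<in>B. (d b * real (\<gamma> b i)) * monomial_at ((\<gamma> b)(i := \<gamma> b i - 1)) (y - a))"
proof
  fix x
  have "((\<lambda>t. \<Sum>b\<in>B. d b * monomial_at (\<gamma> b) (x - a + t *\<^sub>R axis i 1)) has_real_derivative
      (\<Sum>b\<in>B. d b * (real (\<gamma> b i) * monomial_at ((\<gamma> b)(i := \<gamma> b i - 1)) (x - a)))) (at 0)"
    by (intro DERIV_sum DERIV_cmult has_real_derivative_monomial_at)
  then have "partial_deriv i (\<lambda>y. \<Sum>b\<in>B. d b * monomial_at (\<gamma> b) (y - a)) x =
      (\<Sum>b\<in>B. d b * (real (\<gamma> b i) * monomial_at ((\<gamma> b)(i := \<gamma> b i - 1)) (x - a)))"
    unfolding partial_deriv_def by (intro DERIV_imp_deriv) (simp add: algebra_simps)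
  then show "partial_deriv i (\<lambda>y. \<Sum>b\<in>B. d b * monomial_at (\<gamma> b) (y - a)) x =
      (\<Sum>b\<in>B. (d b * real (\<gamma> b i)) * monomial_at ((\<gamma> b)(i := \<gamma> b i - 1)) (x - a))"
    by (simp add: mult.assoc)
qed

text \<open>The falling factorial \<open>n (n - 1) \<cdots> (n - k + 1)\<close> is written with truncated subtraction; for
  \<open>k > n\<close> it is \<open>0\<close> because of the factor with \<open>j = n\<close>, so truncated exponents do no harm.\<close>

lemma funpow_partial_deriv_sum_monomial_at:
  assumes "finite B"
  shows "(partial_deriv i ^^ k) (\<lambda>y. \<Sum>b\<in>B. d b * monomial_at (\<gamma> b) (y - a)) =
    (\<lambda>y. \<Sum>b\<in>B. (d b * (\<Prod>j<k. real (\<gamma> b i - j))) * monomial_at ((\<gamma> b)(i := \<gamma> b i - k)) (y - a))"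
proof (induction k)
  case (Suc k)
  show ?case
    unfolding funpow.simps o_apply Suc partial_deriv_sum_monomial_at[OF assms]
      fun_upd_same fun_upd_upd
    by (simp add: mult_ac fun_upd_def)
qed simp

text \<open>The tail of the list is differentiated first. Distinctness ensures that the exponent of
  the head coordinate is still the original one when its turn comes.\<close>

lemma foldr_partial_deriv_sum_monomial_at:
  assumes "finite B" "distinct xs"
  shows "foldr (\<lambda>i. partial_deriv i ^^ \<alpha> i) xs (\<lambda>y. \<Sum>b\<in>B. d b * monomial_at (\<gamma> b) (y - a)) =
    (\<lambda>y. \<Sum>b\<in>B. (d b * (\<Prod>i\<in>set xs. \<Prod>j<\<alpha> i. real (\<gamma> b i - j))) *
       monomial_at (\<lambda>i. if i \<in> set xs then \<gamma> b i - \<alpha> i else \<gamma> b i) (y - a))"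
  using assms(2)
proof (induction xs)
  case (Cons x xs)
  have "(\<lambda>i. if i \<in> set xs then \<gamma> b i - \<alpha> i else \<gamma> b i)(x := \<gamma> b x - \<alpha> x) =
      (\<lambda>i. if i \<in> set (x # xs) then \<gamma> b i - \<alpha> i else \<gamma> b i)" for b
    by auto
  moreover have "x \<notin> set xs" "distinct xs"
    using Cons.prems by auto
  ultimately show ?case
    unfolding foldr_Cons o_apply Cons.IH[OF \<open>distinct xs\<close>]
      funpow_partial_deriv_sum_monomial_at[OF assms(1)]
    by (simp add: mult_ac del: fun_upd_apply)
qed simp

text \<open>Differentiating termwise and evaluating at the centre of the expansion leaves only the
  term with exponent \<open>\<alpha>\<close>.\<close>

lemma mixed_partial_expansion:
  fixes \<alpha> :: "'n::{finite,linorder} \<Rightarrow> nat"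
  assumes "expands_around a h C N" "\<alpha> \<in> multi_indices_upto N"
  shows "mixed_partial \<alpha> h a = C \<alpha> * (\<Prod>i\<in>UNIV. fact (\<alpha> i))"
proof -
  have h: "h = (\<lambda>y. \<Sum>\<beta>\<in>multi_indices_upto N. C \<beta> * monomial_at \<beta> (y - a))"
    using expands_aroundD[OF assms(1)] by blast
  have *: "(\<Prod>i\<in>UNIV. \<Prod>j<\<alpha> i. real (\<beta> i - j)) * monomial_at (\<lambda>i. \<beta> i - \<alpha> i) 0 =
      (if \<beta> = \<alpha> then \<Prod>i\<in>UNIV. fact (\<alpha> i) else 0)" for \<beta>
  \<comment> \<open>If some \<open>\<beta> i < \<alpha> i\<close>, the factor with
    \<open>j = \<beta> i\<close> vanishes. Otherwise the remaining monomial has exponent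
    \<open>\<beta> - \<alpha>\<close> and is zero at the origin unless this exponent is
    zero.\<close>
  proof (cases "\<exists>i. \<beta> i < \<alpha> i")
    case True
    then have "(\<Prod>i\<in>UNIV. \<Prod>j<\<alpha> i. real (\<beta> i - j)) = 0"
      by force
    then show ?thesis
      using True by auto
  next
    case False
    then have "(\<lambda>i. \<beta> i - \<alpha> i) = (\<lambda>_. 0) \<longleftrightarrow> \<beta> = \<alpha>"
      by (auto simp: fun_eq_iff not_less intro: antisym)
    moreover have "(\<Prod>j<n. real (n - j)) = fact n" for n
      by (simp add: fact_prod_rev lessThan_atLeast0)
    ultimately show ?thesis
      by (simp add: monomial_at_zero)
  qed
  have "mixed_partial \<alpha> h a = (\<Sum>\<beta>\<in>multi_indices_upto N. C \<beta> *
      ((\<Prod>i\<in>UNIV. \<Prod>j<\<alpha> i. real (\<beta> i - j)) * monomial_at (\<lambda>i. \<beta> i - \<alpha> i) 0))"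
    unfolding mixed_partial_def h
    by (simp add: foldr_partial_deriv_sum_monomial_at mult.assoc)
  also have "\<dots> = C \<alpha> * (\<Prod>i\<in>UNIV. fact (\<alpha> i))"
    unfolding * using assms(2) by (simp add: if_distrib cong: if_cong)
  finally show ?thesis .
qed

section \<open>Structured Taylor sums in coordinates\<close>

text \<open>The factor \<open>1 / fact k\<close> cancels the numerator of the multinomial
  coefficient, and the ordering of the columns only reindexes the sum.\<close>

lemma structured_taylor_nth:
  fixes g :: "'n::{finite,linorder} rvec \<Rightarrow> 'n rvec"
  assumes "multi_index_ordering idx"
  shows "structured_taylor idx g c m y $ i =
    (\<Sum>\<alpha>\<in>multi_indices_upto m.
       mixed_partial \<alpha> (\<lambda>y. g y $ i) c / (\<Prod>i\<in>UNIV. fact (\<alpha> i)) * monomial_at \<alpha> (y - c))"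
proof -
  let ?t = "\<lambda>\<alpha>. mixed_partial \<alpha> (\<lambda>y. g y $ i) c / (\<Prod>i\<in>UNIV. fact (\<alpha> i)) * monomial_at \<alpha> (y - c)"
  have "structured_taylor idx g c m y $ i =
      (\<Sum>k\<le>m. \<Sum>j<num_multi_indices TYPE('n) k. ?t (idx k j))"
    by (simp add: structured_taylor_def mat_vec_def deriv_matrix_def monomial_vector_def
        monomial_at_def sum_distrib_left sum_divide_distrib)
  also have "\<dots> = (\<Sum>k\<le>m. sum ?t (multi_indices k))"
    using assms by (intro sum.cong sum.reindex_bij_betw) (auto simp: multi_index_ordering_def)
  finally show ?thesis
    by (simp only: sum_multi_indices_upto)
qed

lemma structured_taylor_polynomial_function:
  fixes g :: "'n::{finite,linorder} rvec \<Rightarrow> 'n rvec"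
  assumes "multi_index_ordering idx" "polynomial_function g"
  obtains m where "structured_taylor idx g c m = g"
proof -
  obtain C N where CN: "\<And>i. expands_around c (\<lambda>y. g y $ i) (C i) N"
    using polynomial_function_expansion[OF assms(2)] by blast
  have "structured_taylor idx g c N y $ i = g y $ i" for y i
    by (simp add: structured_taylor_nth[OF assms(1)] mixed_partial_expansion[OF CN]
        expands_aroundD[OF CN, of y])
  then have "structured_taylor idx g c N = g"
    by (simp add: vec_eq_iff fun_eq_iff)
  with that show thesis .
qed

text \<open>The derivatives of \<open>g\<close> enter only through their values at \<open>c\<close>,
  which are constants in \<open>y\<close>.\<close>

lemma polynomial_function_structured_taylor:
  fixes g :: "'n::{finite,linorder} rvec \<Rightarrow> 'n rvec"
  assumes "multi_index_ordering idx"
  shows "polynomial_function (structured_taylor idx g c m)"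
proof -
  have "real_polynomial_function (\<lambda>y. monomial_at \<alpha> (y - c))" for \<alpha>
    unfolding monomial_at_def vector_minus_component
    by (intro real_polynomial_function_prod real_polynomial_function_power
        real_polynomial_function_diff real_polynomial_function.intros(1,2)
        bounded_linear_vec_nth) simp
  then show ?thesis
    unfolding polynomial_function_nth structured_taylor_nth[OF assms]
    \<comment> \<open>The deleted simp rule would move the monomial into the numerator; without it
      each term stays a constant times a monomial.\<close>
    by (auto intro!: real_polynomial_function_sum real_polynomial_function.intros(2,4)
        simp del: times_divide_eq_left)
qed

section \<open>Smoothness of polynomials\<close>

text \<open>The derivative and the polynomiality of its directional values are built together by
  induction, as the product rule yields again sums of products of polynomials.\<close>

lemma real_polynomial_function_has_derivative:
  fixes h :: "'a::real_normed_vector \<Rightarrow> real"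
  assumes "real_polynomial_function h"
  shows "\<exists>D. (\<forall>x. (h has_derivative D x) (at x)) \<and> (\<forall>v. real_polynomial_function (\<lambda>x. D x v))"
  using assms
proof induction
  case (linear h)
  then show ?case
    by (intro exI[of _ "\<lambda>_. h"]) (auto intro: bounded_linear_imp_has_derivative)
next
  case (const d)
  then show ?case
    by (intro exI[of _ "\<lambda>_ _. 0"]) auto
next
  case (add h k)
  then obtain D E where "\<And>x. (h has_derivative D x) (at x)" "\<And>v. real_polynomial_function (\<lambda>x. D x v)"
    "\<And>x. (k has_derivative E x) (at x)" "\<And>v. real_polynomial_function (\<lambda>x. E x v)"
    by blast
  then show ?case
    by (intro exI[of _ "\<lambda>x v. D x v + E x v"]) (auto intro: has_derivative_add)
next
  case (mult h k)
  then obtain D E where "\<And>x. (h has_derivative D x) (at x)" "\<And>v. real_polynomial_function (\<lambda>x. D x v)"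
    "\<And>x. (k has_derivative E x) (at x)" "\<And>v. real_polynomial_function (\<lambda>x. E x v)"
    by blast
  with mult.hyps show ?case
    by (intro exI[of _ "\<lambda>x v. h x * E x v + D x v * k x"])
      (auto intro!: has_derivative_mult real_polynomial_function.intros(3,4))
qed

text \<open>\<open>frechet_derivative\<close> is a chosen derivative; uniqueness of derivatives
  identifies its components with the polynomial ones. This closure property drives the induction for
  \<open>Ck_on\<close>.\<close>

lemma polynomial_function_frechet_derivative:
  fixes g :: "'a::real_normed_vector \<Rightarrow> 'b::euclidean_space"
  assumes "polynomial_function g"
  shows "polynomial_function (\<lambda>x. frechet_derivative g (at x) v)"
proof -
  have "\<forall>b\<in>Basis. \<exists>D. (\<forall>x. ((\<lambda>y. g y \<bullet> b) has_derivative D x) (at x)) \<and>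
      (\<forall>v. real_polynomial_function (\<lambda>x. D x v))"
    using assms real_polynomial_function_has_derivative
    unfolding polynomial_function_iff_Basis_inner by blast
  then obtain D where D: "\<And>b x. b \<in> Basis \<Longrightarrow> ((\<lambda>y. g y \<bullet> b) has_derivative D b x) (at x)"
    "\<And>b v. b \<in> Basis \<Longrightarrow> real_polynomial_function (\<lambda>x. D b x v)"
    by metis
  have "(g has_derivative frechet_derivative g (at x)) (at x)" for x
    using differentiable_at_polynomial_function[OF assms] frechet_derivative_works by blast
  then have "((\<lambda>y. g y \<bullet> b) has_derivative (\<lambda>v. frechet_derivative g (at x) v \<bullet> b)) (at x)" for x b
    by (rule has_derivative_inner_left)
  then have "(\<lambda>v. frechet_derivative g (at x) v \<bullet> b) = D b x" if "b \<in> Basis" for x b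
    using D(1)[OF that] has_derivative_unique by blast
  then have "(\<lambda>x. frechet_derivative g (at x) v \<bullet> b) = (\<lambda>x. D b x v)" if "b \<in> Basis" for b
    using that by metis
  with D(2) show ?thesis
    unfolding polynomial_function_iff_Basis_inner by simp
qed

lemma Ck_on_polynomial_function:
  fixes g :: "'a::real_normed_vector \<Rightarrow> 'b::euclidean_space"
  assumes "polynomial_function g"
  shows "Ck_on k g S"
  using assms
  by (induction k arbitrary: g)
    (simp_all add: continuous_on_polymonial_function differentiable_at_polynomial_function
      polynomial_function_frechet_derivative)

lemma Cinf_polynomial_function:
  fixes g :: "'a::real_normed_vector \<Rightarrow> 'b::euclidean_space"
  assumes "polynomial_function g"
  shows "restrict g K \<in> Cinf K"
  unfolding Cinf_def smooth_on_def
  using Ck_on_polynomial_function[OF assms] open_UNIV by blast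

section \<open>Density\<close>

lemma smooth_on_imp_continuous_on: "smooth_on f S \<Longrightarrow> continuous_on S f"
  unfolding smooth_on_def by (metis Ck_on.simps(1))

text \<open>Nonnegativity of \<open>B\<close> covers empty \<open>K\<close>, where the norm is 0 by
  convention.\<close>

lemma C0_norm_le:
  assumes "0 \<le> B" "\<And>y. y \<in> K \<Longrightarrow> norm (h y) \<le> B"
  shows "C0_norm K h \<le> B"
  using assms by (auto simp: C0_norm_def intro: cSUP_least)

text \<open>Members of \<open>cfunspace\<close> must be bounded as well as continuous; compactness
  of \<open>K\<close> supplies the bound.\<close>

lemma restrict_in_cfunspace:
  fixes h :: "'a::topological_space \<Rightarrow> 'b::real_normed_vector"
  assumes "compact K" "continuous_on K h"
  shows "restrict h K \<in> mspace (cfunspace (top_of_set K) euclidean_metric)"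
  using assms
  by (subst compactin_mspace_cfunspace) (auto simp: compactin_subtopology cong: continuous_on_cong)

text \<open>The Stone-Weierstrass polynomial coincides with its own Taylor sum of high order, so
  passing to that sum costs no further error.\<close>

lemma structured_taylor_approximation:
  fixes f :: "'n::{finite,linorder} rvec \<Rightarrow> 'n rvec"
  assumes "multi_index_ordering idx" "compact K" "continuous_on K f" "\<epsilon> > 0"
  obtains g m where "polynomial_function g" "\<And>y. y \<in> K \<Longrightarrow> norm (f y - structured_taylor idx g c m y) < \<epsilon>"
  using Stone_Weierstrass_polynomial_function[OF assms(2-4)]
    structured_taylor_polynomial_function[OF assms(1)] by metis

theorem lemma4p7:
  fixes W K :: "'n::{finite,linorder} rvec set"
    and f :: "'n rvec \<Rightarrow> 'n rvec"
    and c :: "'n rvec"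
    and idx :: "nat \<Rightarrow> nat \<Rightarrow> 'n \<Rightarrow> nat"
  assumes "multi_index_ordering idx"
    and "open W" and "compact K" and "K \<subseteq> W"
    and "smooth_on f W"
    and "c \<in> W"
  shows "(\<forall>\<epsilon>>0. \<exists>g m. real_analytic_on g W \<and> polynomial_function g \<and>
            C0_norm K (\<lambda>y. f y - structured_taylor idx g c m y) < \<epsilon>) \<and>
         structured_approximants idx W c K \<subseteq> Cinf K \<and>
         Cinf K \<subseteq> mtopology_of (cfunspace (top_of_set K) euclidean_metric)
                    closure_of structured_approximants idx W c K"
proof (intro conjI allI impI subsetI)
  fix \<epsilon> :: real assume \<epsilon>: "\<epsilon> > 0"
  have "continuous_on K f"
    using assms(4,5) smooth_on_imp_continuous_on continuous_on_subset by blast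
  \<comment> \<open>Half of \<open>\<epsilon>\<close> is used because a supremum of values below a
    bound may attain it.\<close>
  then obtain g m where g: "polynomial_function g"
    "\<And>y. y \<in> K \<Longrightarrow> norm (f y - structured_taylor idx g c m y) < \<epsilon> / 2"
    using structured_taylor_approximation[OF assms(1,3), of f "\<epsilon> / 2" c] \<epsilon> by auto
  have "C0_norm K (\<lambda>y. f y - structured_taylor idx g c m y) \<le> \<epsilon> / 2"
    using \<epsilon> g(2) by (intro C0_norm_le) (auto intro: less_imp_le)
  with \<epsilon> g(1) show "\<exists>g m. real_analytic_on g W \<and> polynomial_function g \<and>
      C0_norm K (\<lambda>y. f y - structured_taylor idx g c m y) < \<epsilon>"
    using real_analytic_on_polynomial_function by (intro exI[of _ g] exI[of _ m]) auto
next
  fix h assume "h \<in> structured_approximants idx W c K"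
  then show "h \<in> Cinf K"
    using Cinf_polynomial_function[OF polynomial_function_structured_taylor[OF assms(1)]]
    unfolding structured_approximants_def by blast
next
  fix h0 :: "'n rvec \<Rightarrow> 'n rvec" assume "h0 \<in> Cinf K"
  then obtain h U where h: "h0 = restrict h K" "K \<subseteq> U" "smooth_on h U"
    unfolding Cinf_def by blast
  then have cont: "continuous_on K h"
    using smooth_on_imp_continuous_on continuous_on_subset by blast
  let ?F = "cfunspace (top_of_set K) (euclidean_metric :: 'n rvec metric)"
  interpret F: Metric_space "mspace ?F" "mdist ?F"
    by (rule Metric_space_mspace_mdist)
  \<comment> \<open>Closure is tested with closed balls, so the bound \<open>\<epsilon>\<close>
    itself suffices here. \<open>h\<close> is smooth near \<open>K\<close> on its own set
    \<open>U\<close>, while its polynomial surrogate is analytic everywhere, in particular on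
    \<open>W\<close>.\<close>
  have "\<exists>k\<in>structured_approximants idx W c K. k \<in> F.mcball h0 \<epsilon>" if \<epsilon>: "\<epsilon> > 0" for \<epsilon>
  proof -
    obtain g m where g: "polynomial_function g"
      "\<And>y. y \<in> K \<Longrightarrow> norm (h y - structured_taylor idx g c m y) < \<epsilon>"
      using structured_taylor_approximation[OF assms(1,3) cont \<epsilon>] by blast
    let ?k = "restrict (structured_taylor idx g c m) K"
    have "?k \<in> structured_approximants idx W c K"
      unfolding structured_approximants_def
      using real_analytic_on_polynomial_function[OF g(1)] by blast
    moreover have "mdist ?F h0 ?k \<le> \<epsilon>"
      using \<epsilon> g(2) h(1) by (intro mdist_cfunspace_le) (auto simp: dist_norm less_imp_le)
    moreover have "?k \<in> mspace ?F" "h0 \<in> mspace ?F"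
      unfolding h(1) using assms(3) cont
      by (auto simp del: mspace_cfunspace intro!: restrict_in_cfunspace continuous_on_polymonial_function
          polynomial_function_structured_taylor assms(1))
    ultimately show ?thesis
      using F.in_mcball by blast
  qed
  moreover have "h0 \<in> mspace ?F"
    unfolding h(1) by (rule restrict_in_cfunspace[OF assms(3) cont])
  ultimately show "h0 \<in> mtopology_of ?F closure_of structured_approximants idx W c K"
    unfolding mtopology_of_def F.metric_closure_of_alt by blast
qed

end
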